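(* Let $k$ and $l$ be positive integers with $k\geq 3$ and $l\geq 2$. Then both the symmetric group and the alternating group of degree $kl$, acting on the set of all $(k,l)$-partitions, are non-synchronizing.
   Context: A $(k,l)$-partition is a partition of the set $[kl]=\{1,2,\dots,kl\}$ into $k$ parts, each of size $l$; the symmetric and alternating groups on $[kl]$ act naturally on the set of $(k,l)$-partitions. A permutation group $G$ acting on a set $\Omega$ is synchronizing if for every map $f:\Omega\to\Omega$ which is not a permutation, the transformation monoid $\langle G,f\rangle$ contains an element sending all of $\Omega$ to a single point. It is non-synchronizing if it is not synchronizing. *)

theory Defs
  imports "HOL-Algebra.Algebra" "HOL-Library.Disjoint_Sets"
begin

text \<open>As in \<^const>\<open>Bij\<close>, maps from \<open>\<Omega>\<close> to \<open>\<Omega>\<close> are represented by extensional functions.\<close>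

definition transformation_monoid :: "'a set \<Rightarrow> ('a \<Rightarrow> 'a) monoid" where
  "transformation_monoid \<Omega> =
     \<lparr>carrier = \<Omega> \<rightarrow>\<^sub>E \<Omega>, monoid.mult = (\<lambda>g f. compose \<Omega> g f), one = (\<lambda>x\<in>\<Omega>. x)\<rparr>"

lemma monoid_transformation_monoid: "monoid (transformation_monoid \<Omega>)"
proof (rule monoidI)
  fix f g h
  assume "f \<in> carrier (transformation_monoid \<Omega>)"
    and "g \<in> carrier (transformation_monoid \<Omega>)"
    and "h \<in> carrier (transformation_monoid \<Omega>)"
  then show "f \<otimes>\<^bsub>transformation_monoid \<Omega>\<^esub> g \<otimes>\<^bsub>transformation_monoid \<Omega>\<^esub> h
    = f \<otimes>\<^bsub>transformation_monoid \<Omega>\<^esub> (g \<otimes>\<^bsub>transformation_monoid \<Omega>\<^esub> h)"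
    by (auto simp: transformation_monoid_def compose_def fun_eq_iff PiE_def Pi_def)
qed (auto simp: transformation_monoid_def compose_def fun_eq_iff PiE_def extensional_def)

text \<open>Unlike \<^const>\<open>generate\<close>, there is no closure under inverses.\<close>

inductive_set monoid_generate :: "('a, 'b) monoid_scheme \<Rightarrow> 'a set \<Rightarrow> 'a set"
  for M and S where
    one:  "\<one>\<^bsub>M\<^esub> \<in> monoid_generate M S"
  | incl: "s \<in> S \<Longrightarrow> s \<in> monoid_generate M S"
  | mult: "s \<in> monoid_generate M S \<Longrightarrow> t \<in> monoid_generate M S
           \<Longrightarrow> s \<otimes>\<^bsub>M\<^esub> t \<in> monoid_generate M S"

text \<open>A permutation group on \<open>\<Omega>\<close> is given by its set \<open>G\<close> of elements, a subgroup of
  \<^term>\<open>BijGroup \<Omega>\<close>.\<close>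

definition synchronizing :: "'a set \<Rightarrow> ('a \<Rightarrow> 'a) set \<Rightarrow> bool" where
  "synchronizing \<Omega> G \<longleftrightarrow>
     (\<forall>f \<in> \<Omega> \<rightarrow>\<^sub>E \<Omega>. f \<notin> Bij \<Omega> \<longrightarrow>
        (\<exists>h \<in> monoid_generate (transformation_monoid \<Omega>) (G \<union> {f}).
           \<exists>a \<in> \<Omega>. \<forall>x \<in> \<Omega>. h x = a))"

definition kl_partitions :: "nat \<Rightarrow> nat \<Rightarrow> nat set set set" where
  "kl_partitions k l =
     {P. partition_on {1..k * l} P \<and> card P = k \<and> (\<forall>B \<in> P. card B = l)}"

definition kl_action :: "nat \<Rightarrow> nat \<Rightarrow> (nat \<Rightarrow> nat) \<Rightarrow> nat set set \<Rightarrow> nat set set" where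
  "kl_action k l p = (\<lambda>P \<in> kl_partitions k l. (\<lambda>B. p ` B) ` P)"

lemma kl_action_closed:
  assumes p: "p permutes {1..k * l}" and P: "P \<in> kl_partitions k l"
  shows "(\<lambda>B. p ` B) ` P \<in> kl_partitions k l"
proof -
  have inj: "inj p" using p by (rule permutes_inj)
  have part: "partition_on {1..k * l} P" and card: "card P = k" "\<forall>B \<in> P. card B = l"
    using P by (auto simp: kl_partitions_def)
  have "partition_on (p ` {1..k * l}) ((\<lambda>B. p ` B) ` P)"
  proof (rule partition_onI)
    show "\<Union> ((\<lambda>B. p ` B) ` P) = p ` {1..k * l}"
      using partition_onD1[OF part] by (simp add: image_Union)
    show "disjnt B C" if "B \<in> (\<lambda>B. p ` B) ` P" "C \<in> (\<lambda>B. p ` B) ` P" "B \<noteq> C" for B C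
    proof -
      from that obtain B' C' where "B' \<in> P" "C' \<in> P" "B' \<noteq> C'" "B = p ` B'" "C = p ` C'"
        by blast
      then show ?thesis
        using partition_onD2[OF part] inj by (simp add: disjnt_def disjoint_def flip: image_Int)
    qed
    show "{} \<notin> (\<lambda>B. p ` B) ` P"
      using partition_onD3[OF part] by auto
  qed
  then have "partition_on {1..k * l} ((\<lambda>B. p ` B) ` P)"
    by (simp only: permutes_image[OF p])
  moreover have "inj_on (\<lambda>B. p ` B) P"
    using inj by (simp add: inj_on_def inj_image_eq_iff)
  ultimately show ?thesis
    using card inj by (auto simp: kl_partitions_def card_image inj_on_subset[OF inj])
qed

lemma kl_action_compose:
  assumes "p permutes {1..k * l}" "q permutes {1..k * l}"
  shows "kl_action k l (p \<circ> q) = compose (kl_partitions k l) (kl_action k l p) (kl_action k l q)"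
  using kl_action_closed[OF assms(2)]
  by (auto simp: kl_action_def compose_def fun_eq_iff image_image image_comp o_def)

lemma kl_action_Bij:
  assumes p: "p permutes {1..k * l}"
  shows "kl_action k l p \<in> Bij (kl_partitions k l)"
proof -
  let ?q = "Hilbert_Choice.inv p"
  have q: "?q permutes {1..k * l}" using p by (rule permutes_inv)
  have "bij_betw (kl_action k l p) (kl_partitions k l) (kl_partitions k l)"
    by (rule bij_betw_byWitness[where f' = "kl_action k l ?q"])
      (auto simp: kl_action_def kl_action_closed[OF p] kl_action_closed[OF q] image_image
        permutes_inverses[OF p])
  then show ?thesis by (simp add: Bij_def kl_action_def)
qed

lemma group_action_sym_group:
  "group_action (sym_group (k * l)) (kl_partitions k l) (kl_action k l)"
proof -
  have "kl_action k l \<in> hom (sym_group (k * l)) (BijGroup (kl_partitions k l))"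
    by (auto simp: hom_def sym_group_def BijGroup_def kl_action_Bij kl_action_compose)
  then show ?thesis
    by (simp add: group_action_def group_hom_def group_hom_axioms_def
        sym_group_is_group group_BijGroup)
qed

lemma group_action_alt_group:
  "group_action (alt_group (k * l)) (kl_partitions k l) (kl_action k l)"
proof -
  have "kl_action k l \<in> hom (alt_group (k * l)) (BijGroup (kl_partitions k l))"
    by (auto simp: hom_def alt_group_def sym_group_def BijGroup_def kl_action_Bij kl_action_compose)
  then show ?thesis
    by (simp add: group_action_def group_hom_def group_hom_axioms_def
        alt_group_is_group group_BijGroup)
qed

end

theory Submission
  imports Defs
begin

text \<open>
  Join two \<open>(k,l)\<close>-partitions by an edge when they have no part in common. This graph is invariant
  under every permutation of the points. Colouring a partition by its part through the point \<open>1\<close> is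
  a proper colouring, since adjacent partitions share no part. By Baranyai's theorem the \<open>l\<close>-subsets
  of \<open>{1..k * l}\<close> can be distributed over partitions so that every \<open>l\<close>-subset is a part of exactly
  one of them; these partitions form a clique, and it meets every colour because every \<open>l\<close>-subset
  through \<open>1\<close> is used. Sending each partition to the clique member of the same colour is then a graph
  endomorphism \<open>f\<close>. It is not injective, because for \<open>k \<ge> 3\<close> and \<open>l \<ge> 2\<close> the points outside one
  part can be divided up in more than one way. The group together with \<open>f\<close> generates a monoid of
  graph endomorphisms, and an endomorphism keeps the two ends of an edge apart, so no element of the
  monoid is constant (\<open>not_synchronizing_if_clique_colouring\<close>). The argument applies to any set of
  permutations of the points, hence to both groups.

  Baranyai's theorem is proved by the method of Brouwer and Schrijver. The partitions are built up
  simultaneously by adding one point at a time. The number of times that a set \<open>S\<close> of the first \<open>t\<close>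
  points occurs as a partial part is kept equal to the number of ways to complete \<open>S\<close> to an
  \<open>l\<close>-set by the remaining \<open>k * l - t\<close> points. To add the next point, one part of every partial
  partition has to be enlarged, in such a way that each \<open>S\<close> is enlarged the correct number of times.
  A fractional solution is obvious: enlarge a part \<open>S\<close> with weight
  \<open>(l - card S) / (k * l - t)\<close>. Its existence yields Hall's condition, and
  Hall's theorem gives an integral solution.
\<close>

section \<open>Hall's marriage theorem\<close>

text \<open>
  Rado's proof. As long as some \<open>A i\<close> has two elements \<open>x\<close> and \<open>y\<close>, one of them can be removed
  without violating Hall's condition: if \<open>J\<close> witnessed a violation for \<open>x\<close> and \<open>K\<close> one for \<open>y\<close>,
  then comparing the union and the intersection of the two neighbourhoods with \<open>J \<union> K \<union> {i}\<close> and
  \<open>J \<inter> K\<close> would contradict the condition for \<open>A\<close>. Once all \<open>A i\<close> are singletons, the condition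
  says that they are distinct.
\<close>

theorem hall_marriage:
  fixes A :: "'i \<Rightarrow> 'a set"
  assumes "finite I" and "\<And>i. i \<in> I \<Longrightarrow> finite (A i)"
    and "\<And>J. J \<subseteq> I \<Longrightarrow> card J \<le> card (\<Union>i\<in>J. A i)"
  shows "\<exists>f. inj_on f I \<and> (\<forall>i\<in>I. f i \<in> A i)"
  using assms
proof (induction "\<Sum>i\<in>I. card (A i)" arbitrary: A rule: less_induct)
  case less
  note finI = less.prems(1) and finA = less.prems(2) and hall = less.prems(3)
  show ?case
  proof (cases "\<forall>i\<in>I. card (A i) \<le> 1")
    case True
    have "card (A i) = 1" if "i \<in> I" for i
      using hall[of "{i}"] True that by force
    then have "\<forall>i\<in>I. \<exists>x. A i = {x}"
      by (simp add: card_1_singleton_iff)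
    then obtain f where f: "\<And>i. i \<in> I \<Longrightarrow> A i = {f i}"
      by metis
    have "inj_on f I"
    proof (rule inj_onI, rule ccontr)
      fix i j assume "i \<in> I" "j \<in> I" "f i = f j" "i \<noteq> j"
      then show False
        using hall[of "{i, j}"] f by simp
    qed
    with f show ?thesis by blast
  next
    case False
    then obtain i where i: "i \<in> I" "\<not> card (A i) \<le> 1" by blast
    then obtain x y where xy: "x \<in> A i" "y \<in> A i" "x \<noteq> y"
      using card_le_Suc0_iff_eq[OF finA[OF i(1)]] by auto
    \<comment> \<open>Removing \<open>z\<close> either leads to a transversal or produces a violating set; the violating set
      must contain \<open>i\<close>, and \<open>J\<close> is what remains of it.\<close>
    have reduce: "(\<exists>f. inj_on f I \<and> (\<forall>i\<in>I. f i \<in> A i)) \<or>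
        (\<exists>J. J \<subseteq> I - {i} \<and> card ((\<Union>j\<in>J. A j) \<union> (A i - {z})) \<le> card J)"
      if z: "z \<in> A i" for z
    proof -
      let ?B = "A(i := A i - {z})"
      show ?thesis
      proof (cases "\<forall>J\<subseteq>I. card J \<le> card (\<Union>j\<in>J. ?B j)")
        case True
        have finB: "finite (?B j)" if "j \<in> I" for j
          using finA[OF that] by (cases "j = i") auto
        have smaller: "(\<Sum>j\<in>I. card (?B j)) < (\<Sum>j\<in>I. card (A j))"
        proof (rule sum_strict_mono_ex1[OF finI])
          show "\<forall>j\<in>I. card (?B j) \<le> card (A j)"
            using finA by (auto intro: card_mono)
          show "\<exists>j\<in>I. card (?B j) < card (A j)"
            using i(1) card_Diff1_less[OF finA[OF i(1)] z] by (metis fun_upd_same)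
        qed
        obtain f where "inj_on f I" "\<forall>j\<in>I. f j \<in> ?B j"
          using less.hyps[OF smaller finI finB] True by blast
        then have "\<forall>j\<in>I. f j \<in> A j"
          by (metis DiffD1 fun_upd_apply)
        with \<open>inj_on f I\<close> show ?thesis by blast
      next
        case False
        then obtain J where J: "J \<subseteq> I" "card (\<Union>j\<in>J. ?B j) < card J"
          by (auto simp: not_le)
        have "i \<in> J"
        proof (rule ccontr)
          assume "i \<notin> J"
          then have "(\<Union>j\<in>J. ?B j) = (\<Union>j\<in>J. A j)" by auto
          with J hall[of J] show False by simp
        qed
        moreover have "(\<Union>j\<in>J. ?B j) = (\<Union>j\<in>J - {i}. A j) \<union> (A i - {z})"
          using \<open>i \<in> J\<close> by (auto split: if_splits)
        moreover have "finite J" using J(1) finI finite_subset by blast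
        ultimately have "card ((\<Union>j\<in>J - {i}. A j) \<union> (A i - {z})) \<le> card (J - {i})"
          using J(2) by simp
        then show ?thesis using J(1) by blast
      qed
    qed
    show ?thesis
    proof (rule ccontr)
      assume no: "\<not> ?thesis"
      obtain J where J: "J \<subseteq> I - {i}" "card ((\<Union>j\<in>J. A j) \<union> (A i - {x})) \<le> card J"
        using reduce[OF xy(1)] no by blast
      obtain K where K: "K \<subseteq> I - {i}" "card ((\<Union>j\<in>K. A j) \<union> (A i - {y})) \<le> card K"
        using reduce[OF xy(2)] no by blast
      let ?U = "(\<Union>j\<in>J. A j) \<union> (A i - {x})" and ?V = "(\<Union>j\<in>K. A j) \<union> (A i - {y})"
      have fin: "finite J" "finite K"
        using J(1) K(1) finI finite_subset by blast+
      have finUV: "finite ?U" "finite ?V"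
        using fin J(1) K(1) finA i(1) by (auto intro!: finite_UN_I)
      have "card (insert i (J \<union> K)) \<le> card (\<Union>j\<in>insert i (J \<union> K). A j)"
        using J(1) K(1) i(1) by (intro hall) auto
      also have "(\<Union>j\<in>insert i (J \<union> K). A j) = ?U \<union> ?V"
        using xy by auto
      finally have 1: "Suc (card (J \<union> K)) \<le> card (?U \<union> ?V)"
        using J(1) K(1) fin by (subst (asm) card_insert_disjoint) auto
      have "card (J \<inter> K) \<le> card (\<Union>j\<in>J \<inter> K. A j)"
        using J(1) by (intro hall) auto
      also have "\<dots> \<le> card (?U \<inter> ?V)"
        using finUV by (intro card_mono) auto
      finally have 2: "card (J \<inter> K) \<le> card (?U \<inter> ?V)" .
      show False
        using 1 2 J(2) K(2) card_Un_Int[OF fin] card_Un_Int[OF finUV] by linarith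
    qed
  qed
qed

section \<open>Baranyai's theorem\<close>

text \<open>
  A partial partition into \<open>k\<close> parts, of which several may be empty, is encoded as a colouring of
  the points; the colour classes are then disjoint automatically, and empty parts keep their
  multiplicity.
\<close>

definition colour_class :: "(nat \<Rightarrow> nat) \<Rightarrow> nat \<Rightarrow> nat \<Rightarrow> nat set" where
  "colour_class c t p = {x \<in> {1..t}. c x = p}"

text \<open>
  The invariant of the construction. Since \<open>l - card S\<close> is truncated, sets with more than \<open>l\<close>
  elements are treated separately: they cannot be completed to an \<open>l\<close>-set. For \<open>t = k * l\<close> the
  prescribed number is \<open>1\<close> for the \<open>l\<close>-sets and \<open>0\<close> for all other sets.
\<close>

definition balanced_colourings :: "nat \<Rightarrow> nat \<Rightarrow> nat \<Rightarrow> nat \<Rightarrow> (nat \<Rightarrow> nat \<Rightarrow> nat) \<Rightarrow> bool" where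
  "balanced_colourings k l m t c \<longleftrightarrow>
     (\<forall>i<m. \<forall>x\<in>{1..t}. c i x < k) \<and>
     (\<forall>S. S \<subseteq> {1..t} \<longrightarrow>
        card {(i, p) \<in> {..<m} \<times> {..<k}. colour_class (c i) t p = S} =
        (if card S \<le> l then (k * l - t) choose (l - card S) else 0))"

text \<open>
  How often the point \<open>t + 1\<close> has to be added to the part \<open>S\<close>: the number of \<open>l\<close>-sets that extend
  \<open>insert (t + 1) S\<close> by later points.
\<close>

definition extension_count :: "nat \<Rightarrow> nat \<Rightarrow> nat \<Rightarrow> nat set \<Rightarrow> nat" where
  "extension_count k l t S =
     (if card S < l then (k * l - Suc t) choose (l - Suc (card S)) else 0)"

lemma colour_class_subset: "colour_class c t p \<subseteq> {1..t}"
  by (auto simp: colour_class_def)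

lemma sum_card_colour_class:
  assumes "\<forall>x\<in>{1..t}. c x < k"
  shows "(\<Sum>p<k. card (colour_class c t p)) = t"
  using sum.group[of "{1..t}" "{..<k}" c "\<lambda>_. 1::nat"] assms
  by (auto simp: colour_class_def)

text \<open>
  With weight \<open>(l - card S) / (k * l - t)\<close> on each occurrence of \<open>S\<close>, the total weight on \<open>S\<close> is
  \<open>extension_count k l t S\<close>. The denominator is cleared here.
\<close>

lemma weighted_extension_count:
  assumes "t < k * l" and "card S \<le> l"
  shows "(l - card S) * ((k * l - t) choose (l - card S)) = (k * l - t) * extension_count k l t S"
proof (cases "card S < l")
  case True
  then obtain a where a: "l - card S = Suc a" "l - Suc (card S) = a"
    by (metis Suc_diff_Suc)
  moreover obtain b where "k * l - t = Suc b" "k * l - Suc t = b"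
    using assms(1) by (metis Suc_diff_Suc)
  ultimately show ?thesis
    using Suc_times_binomial[of a b] True by (simp add: extension_count_def)
qed (simp add: extension_count_def)

text \<open>
  Give each set \<open>S\<close> a number of slots equal to its \<open>extension_count\<close>, and let colouring \<open>i\<close> compete
  for the slots of its own parts. The weights \<open>l - card S\<close> of the parts of one colouring sum to
  \<open>k * l - t\<close>, whereas the weights of all occurrences of one \<open>S\<close> sum to \<open>k * l - t\<close> times the number
  of its slots. Double counting thus gives Hall's condition, and also shows that there are exactly
  as many slots as colourings, so that a transversal fills every slot.
\<close>

lemma ex_balanced_extension:
  assumes bal: "balanced_colourings k l m t c" and t: "t < k * l"
  shows "\<exists>p. (\<forall>i<m. p i < k) \<and>
    (\<forall>S. S \<subseteq> {1..t} \<longrightarrow>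
       card {i. i < m \<and> colour_class (c i) t (p i) = S} = extension_count k l t S)"
proof -
  define a where "a = (\<lambda>(i, p). colour_class (c i) t p)"
  define cap where "cap = extension_count k l t"
  define slots where "slots T = Sigma T (\<lambda>S. {..<cap S})" for T :: "nat set set"
  have a_sub: "a x \<subseteq> {1..t}" for x
    by (cases x) (use colour_class_subset in \<open>auto simp: a_def\<close>)
  have a_count: "card {x \<in> {..<m} \<times> {..<k}. a x = S} =
      (if card S \<le> l then (k * l - t) choose (l - card S) else 0)" if "S \<subseteq> {1..t}" for S
  proof -
    have "{x \<in> {..<m} \<times> {..<k}. a x = S} =
        {(i, p) \<in> {..<m} \<times> {..<k}. colour_class (c i) t p = S}"
      by (auto simp: a_def)
    then show ?thesis using bal that by (simp add: balanced_colourings_def)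
  qed
  have a_le: "card (a x) \<le> l" if x: "x \<in> {..<m} \<times> {..<k}" for x
  proof (rule ccontr)
    assume "\<not> card (a x) \<le> l"
    then have "card {y \<in> {..<m} \<times> {..<k}. a y = a x} = 0"
      using a_count[OF a_sub] by simp
    then have "{y \<in> {..<m} \<times> {..<k}. a y = a x} = {}"
      by (subst (asm) card_eq_0_iff) simp
    then show False using x by blast
  qed
  have weight: "(\<Sum>p<k. l - card (a (i, p))) = k * l - t" if "i < m" for i
  proof -
    have "(\<Sum>p<k. l - card (a (i, p))) = (\<Sum>p<k. l) - (\<Sum>p<k. card (a (i, p)))"
      using a_le that by (intro sum_subtractf_nat) auto
    also have "(\<Sum>p<k. card (a (i, p))) = t"
      using bal that sum_card_colour_class[of t "c i" k]
      by (auto simp: balanced_colourings_def a_def)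
    finally show ?thesis by simp
  qed
  have count: "card J * (k * l - t) =
      (\<Sum>S\<in>T. card {x \<in> J \<times> {..<k}. a x = S} * (l - card S))"
    if J: "J \<subseteq> {..<m}" and T: "a ` (J \<times> {..<k}) \<subseteq> T" "finite T" for J T
  proof -
    have finJ: "finite J" using J finite_subset by blast
    have "card J * (k * l - t) = (\<Sum>i\<in>J. \<Sum>p<k. l - card (a (i, p)))"
      using weight J by (simp add: subset_eq)
    also have "\<dots> = (\<Sum>x\<in>J \<times> {..<k}. l - card (a x))"
      by (simp add: sum.cartesian_product)
    also have "\<dots> = (\<Sum>S\<in>T. \<Sum>x\<in>{x \<in> J \<times> {..<k}. a x = S}. l - card (a x))"
      using T finJ by (intro sum.group[symmetric]) auto
    also have "\<dots> = (\<Sum>S\<in>T. card {x \<in> J \<times> {..<k}. a x = S} * (l - card S))"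
      by simp
    finally show ?thesis .
  qed
  \<comment> \<open>For \<open>card S > l\<close> both sides vanish, since \<open>S\<close> does not occur and has no slots.\<close>
  have full: "card {x \<in> {..<m} \<times> {..<k}. a x = S} * (l - card S) = (k * l - t) * cap S"
    if "S \<subseteq> {1..t}" for S
    using a_count[OF that] weighted_extension_count[OF t, of S]
    by (cases "card S \<le> l") (auto simp: cap_def extension_count_def mult.commute)
  have card_slots: "card (slots T) = (\<Sum>S\<in>T. cap S)" if "finite T" for T
    using that by (simp add: slots_def)
  have hall: "card J \<le> card (\<Union>i\<in>J. slots (a ` ({i} \<times> {..<k})))" if J: "J \<subseteq> {..<m}" for J
  proof -
    let ?T = "a ` (J \<times> {..<k})"
    have finJ: "finite J" using J finite_subset by blast
    have "card J * (k * l - t) = (\<Sum>S\<in>?T. card {x \<in> J \<times> {..<k}. a x = S} * (l - card S))"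
      using finJ by (intro count[OF J]) auto
    also have "\<dots> \<le> (\<Sum>S\<in>?T. card {x \<in> {..<m} \<times> {..<k}. a x = S} * (l - card S))"
      using J by (intro sum_mono mult_right_mono card_mono) auto
    also have "\<dots> = (\<Sum>S\<in>?T. (k * l - t) * cap S)"
      using a_sub by (intro sum.cong refl full) auto
    also have "\<dots> = card (slots ?T) * (k * l - t)"
      using finJ by (simp add: card_slots sum_distrib_left mult.commute)
    finally have "card J \<le> card (slots ?T)" using t by simp
    also have "slots ?T = (\<Union>i\<in>J. slots (a ` ({i} \<times> {..<k})))"
      by (auto simp: slots_def)
    finally show ?thesis .
  qed
  obtain f where inj: "inj_on f {..<m}" and f: "\<And>i. i < m \<Longrightarrow> f i \<in> slots (a ` ({i} \<times> {..<k}))"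
    using hall_marriage[of "{..<m}" "\<lambda>i. slots (a ` ({i} \<times> {..<k}))"] hall
    by (auto simp: slots_def)
  have "\<forall>i\<in>{..<m}. \<exists>p. p < k \<and> fst (f i) = a (i, p)"
    using f by (fastforce simp: slots_def)
  then obtain p where p: "\<And>i. i < m \<Longrightarrow> p i < k" "\<And>i. i < m \<Longrightarrow> fst (f i) = a (i, p i)"
    by (metis lessThan_iff)
  have "m * (k * l - t) = (\<Sum>S\<in>Pow {1..t}. (k * l - t) * cap S)"
    using count[of "{..<m}" "Pow {1..t}"] a_sub full by (auto simp: image_subset_iff)
  also have "\<dots> = card (slots (Pow {1..t})) * (k * l - t)"
    by (simp add: card_slots sum_distrib_left mult.commute)
  finally have "card (slots (Pow {1..t})) = m" using t by simp
  moreover have "f ` {..<m} \<subseteq> slots (Pow {1..t})"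
    using f a_sub by (fastforce simp: slots_def)
  ultimately have img: "f ` {..<m} = slots (Pow {1..t})"
    using inj by (intro card_subset_eq) (auto simp: card_image slots_def)
  have "card {i. i < m \<and> a (i, p i) = S} = cap S" if S: "S \<subseteq> {1..t}" for S
  proof -
    have "f ` {i. i < m \<and> a (i, p i) = S} = {S} \<times> {..<cap S}"
    proof (intro equalityI subsetI)
      fix y assume "y \<in> f ` {i. i < m \<and> a (i, p i) = S}"
      then obtain i where "i < m" "a (i, p i) = S" "y = f i" by blast
      then show "y \<in> {S} \<times> {..<cap S}"
        using f[of i] p(2)[of i] by (auto simp: slots_def)
    next
      fix y assume y: "y \<in> {S} \<times> {..<cap S}"
      then have "y \<in> f ` {..<m}" using S unfolding img by (auto simp: slots_def)
      then obtain i where "i < m" "y = f i" by blast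
      then show "y \<in> f ` {i. i < m \<and> a (i, p i) = S}"
        using y p(2)[of i] by auto
    qed
    moreover have "inj_on f {i. i < m \<and> a (i, p i) = S}"
      using inj by (rule inj_on_subset) auto
    ultimately show ?thesis
      using card_image by fastforce
  qed
  then show ?thesis
    using p(1) by (intro exI[of _ p]) (simp add: a_def cap_def)
qed

text \<open>
  The numbers of occurrences after one step: a set containing the new point \<open>t + 1\<close> occurs as often
  as it was chosen for extension, and a set without it loses the chosen occurrences, which is
  Pascal's rule.
\<close>

lemma balanced_colourings_Suc:
  assumes bal: "balanced_colourings k l m t c" and t: "t < k * l"
  shows "\<exists>c'. balanced_colourings k l m (Suc t) c'"
proof -
  obtain p where p: "\<And>i. i < m \<Longrightarrow> p i < k"
    and chosen: "\<And>S. S \<subseteq> {1..t} \<Longrightarrow>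
      card {i. i < m \<and> colour_class (c i) t (p i) = S} = extension_count k l t S"
    using ex_balanced_extension[OF assms] by blast
  define c' where "c' i = (c i)(Suc t := p i)" for i
  have cls: "colour_class (c' i) (Suc t) q =
      (if q = p i then insert (Suc t) (colour_class (c i) t q) else colour_class (c i) t q)" for i q
    by (auto simp: colour_class_def c'_def)
  \<comment> \<open>The occurrences of \<open>S\<close> that receive the new point.\<close>
  define H where "H S = (\<lambda>i. (i, p i)) ` {i. i < m \<and> colour_class (c i) t (p i) = S}" for S
  have cardH: "card (H S) = extension_count k l t S" if "S \<subseteq> {1..t}" for S
    unfolding H_def using chosen[OF that] by (subst card_image) (auto intro: inj_onI)
  have notin: "Suc t \<notin> colour_class (c i) t q" for i q
    by (simp add: colour_class_def)
  have counts: "card {(i, q) \<in> {..<m} \<times> {..<k}. colour_class (c' i) (Suc t) q = S} =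
      (if card S \<le> l then (k * l - Suc t) choose (l - card S) else 0)"
    if S: "S \<subseteq> {1..Suc t}" for S
  proof (cases "Suc t \<in> S")
    case True
    have S': "S - {Suc t} \<subseteq> {1..t}" using S by force
    have "{(i, q) \<in> {..<m} \<times> {..<k}. colour_class (c' i) (Suc t) q = S} = H (S - {Suc t})"
    proof (intro equalityI subsetI)
      fix x assume "x \<in> {(i, q) \<in> {..<m} \<times> {..<k}. colour_class (c' i) (Suc t) q = S}"
      then obtain i q where x: "x = (i, q)" "i < m" "colour_class (c' i) (Suc t) q = S"
        by blast
      then have "q = p i" using True notin[of i q] by (auto simp: cls split: if_splits)
      moreover from this have "colour_class (c i) t q = S - {Suc t}"
        using x(3) notin[of i q] by (auto simp: cls)
      ultimately show "x \<in> H (S - {Suc t})" using x by (auto simp: H_def)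
    next
      fix x assume "x \<in> H (S - {Suc t})"
      then show "x \<in> {(i, q) \<in> {..<m} \<times> {..<k}. colour_class (c' i) (Suc t) q = S}"
        using True p by (auto simp: H_def cls)
    qed
    moreover have "card S = Suc (card (S - {Suc t}))"
      using True S by (metis card.remove finite_atLeastAtMost finite_subset)
    ultimately show ?thesis
      using cardH[OF S'] by (auto simp: extension_count_def)
  next
    case False
    then have S': "S \<subseteq> {1..t}" using S by (force simp: le_Suc_eq)
    let ?X = "{(i, q) \<in> {..<m} \<times> {..<k}. colour_class (c i) t q = S}"
    have fin: "finite ?X" by (rule finite_subset[of _ "{..<m} \<times> {..<k}"]) auto
    have sub: "H S \<subseteq> ?X" using p by (auto simp: H_def)
    have "{(i, q) \<in> {..<m} \<times> {..<k}. colour_class (c' i) (Suc t) q = S} = ?X - H S"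
      using False by (auto simp: cls H_def split: if_splits)
    then have "card {(i, q) \<in> {..<m} \<times> {..<k}. colour_class (c' i) (Suc t) q = S}
        = card ?X - extension_count k l t S"
      using card_Diff_subset[OF finite_subset[OF sub fin] sub] cardH[OF S'] by simp
    moreover have "card ?X = (if card S \<le> l then (k * l - t) choose (l - card S) else 0)"
      using bal S' by (simp add: balanced_colourings_def)
    moreover have "((k * l - t) choose (l - card S)) - extension_count k l t S
        = (k * l - Suc t) choose (l - card S)" if "card S \<le> l"
    proof (cases "card S = l")
      case False
      with that have *: "l - card S = Suc (l - Suc (card S))" by simp
      have **: "k * l - t = Suc (k * l - Suc t)" using t by simp
      show ?thesis
        unfolding * ** using False that by (simp add: extension_count_def)
    qed (simp add: extension_count_def)
    ultimately show ?thesis by (auto simp: extension_count_def)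
  qed
  have "\<forall>i<m. \<forall>x\<in>{1..Suc t}. c' i x < k"
    using bal p by (auto simp: balanced_colourings_def c'_def)
  then have "balanced_colourings k l m (Suc t) c'"
    unfolding balanced_colourings_def
    by (intro conjI) (assumption, intro allI impI, rule counts)
  then show ?thesis by blast
qed

text \<open>
  The number of colourings is forced by \<open>t = 0\<close>, where the empty set occurs \<open>k\<close> times in each
  colouring and has to occur \<open>(k * l) choose l\<close> times in total.
\<close>

lemma ex_balanced_colourings:
  assumes "k > 0" and "l > 0" and "t \<le> k * l"
  shows "\<exists>c. balanced_colourings k l ((k * l - 1) choose (l - 1)) t c"
  using assms(3)
proof (induction t)
  case 0
  have "k * ((k * l - 1) choose (l - 1)) = (k * l) choose l"
  proof -
    have "l * ((k * l) choose l) = l * (k * ((k * l - 1) choose (l - 1)))"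
      using times_binomial_minus1_eq[OF assms(2), of "k * l"] by (simp only: ac_simps)
    then show ?thesis using assms(2) by (metis mult_left_cancel not_gr_zero)
  qed
  moreover have "{(i, p). i < m \<and> p < k} = {..<m} \<times> {..<k}" for m
    by auto
  ultimately have "balanced_colourings k l ((k * l - 1) choose (l - 1)) 0 (\<lambda>_ _. 0)"
    by (simp add: balanced_colourings_def colour_class_def mult.commute)
  then show ?case by blast
next
  case (Suc t)
  then show ?case using balanced_colourings_Suc[of k l _ t] by auto
qed

theorem baranyai:
  assumes "l > 0"
  shows "\<exists>K \<subseteq> kl_partitions k l. \<forall>S. S \<subseteq> {1..k * l} \<and> card S = l \<longrightarrow> (\<exists>!P. P \<in> K \<and> S \<in> P)"
proof (cases "k = 0")
  case True
  then show ?thesis using assms by (intro exI[of _ "{}"]) auto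
next
  case False
  define m where "m = ((k * l - 1) choose (l - 1))"
  obtain c where bal: "balanced_colourings k l m (k * l) c"
    using ex_balanced_colourings[of k l "k * l"] False assms by (auto simp: m_def)
  define a where "a i p = colour_class (c i) (k * l) p" for i p
  define P where "P i = a i ` {..<k}" for i
  have count: "card {(i, p) \<in> {..<m} \<times> {..<k}. a i p = S} = (if card S = l then 1 else 0)"
    if "S \<subseteq> {1..k * l}" for S
    using bal that by (auto simp: balanced_colourings_def a_def)
  have a_sub: "a i p \<subseteq> {1..k * l}" for i p
    unfolding a_def by (rule colour_class_subset)
  have a_card: "card (a i p) = l" if "i < m" "p < k" for i p
  proof (rule ccontr)
    assume "card (a i p) \<noteq> l"
    moreover have "finite {(j, q) \<in> {..<m} \<times> {..<k}. a j q = a i p}"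
      by (rule finite_subset[of _ "{..<m} \<times> {..<k}"]) auto
    ultimately have "{(j, q) \<in> {..<m} \<times> {..<k}. a j q = a i p} = {}"
      using count[OF a_sub, of i p] by simp
    then show False using that by auto
  qed
  have a_ne: "a i p \<noteq> {}" if "i < m" "p < k" for i p
    using a_card[OF that] assms by auto
  have a_disj: "a i p \<inter> a i q = {}" if "p \<noteq> q" for i p q
    using that by (auto simp: a_def colour_class_def)
  have P_part: "P i \<in> kl_partitions k l" if i: "i < m" for i
  proof -
    have "inj_on (a i) {..<k}"
      using a_disj a_ne[OF i] by (intro inj_onI) (metis Int_absorb lessThan_iff)
    then have "card (P i) = k" by (simp add: P_def card_image)
    moreover have "\<Union> (P i) = {1..k * l}"
      using bal i a_sub by (auto simp: P_def a_def colour_class_def balanced_colourings_def)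
    moreover have "disjoint (P i)"
    proof (rule disjointI)
      fix B C assume "B \<in> P i" "C \<in> P i" "B \<noteq> C"
      then obtain p q where "B = a i p" "C = a i q" "p \<noteq> q" by (auto simp: P_def)
      then show "B \<inter> C = {}" using a_disj by simp
    qed
    moreover have "{} \<notin> P i" "\<forall>B\<in>P i. card B = l"
      using a_ne[OF i] a_card[OF i] by (force simp: P_def)+
    ultimately show ?thesis
      by (simp add: kl_partitions_def partition_on_def)
  qed
  have "\<exists>!Q. Q \<in> P ` {..<m} \<and> S \<in> Q" if S: "S \<subseteq> {1..k * l}" "card S = l" for S
  proof -
    obtain x where x: "{(i, p) \<in> {..<m} \<times> {..<k}. a i p = S} = {x}"
      using count[OF S(1)] S(2) by (metis (no_types, lifting) card_1_singletonE)
    show ?thesis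
    proof (rule ex1I[of _ "P (fst x)"])
      show "P (fst x) \<in> P ` {..<m} \<and> S \<in> P (fst x)"
      proof -
        obtain i p where ip: "x = (i, p)" by force
        have "x \<in> {(i, p) \<in> {..<m} \<times> {..<k}. a i p = S}" unfolding x by simp
        then show ?thesis using ip by (auto simp: P_def)
      qed
      fix Q assume "Q \<in> P ` {..<m} \<and> S \<in> Q"
      then obtain i p where "i < m" "p < k" "a i p = S" "Q = P i" by (auto simp: P_def)
      then have "(i, p) \<in> {x}" unfolding x[symmetric] by simp
      with \<open>Q = P i\<close> show "Q = P (fst x)" by auto
    qed
  qed
  then show ?thesis using P_part by (intro exI[of _ "P ` {..<m}"]) auto
qed

section \<open>Non-synchronizing permutation groups\<close>

text \<open>
  Moving each vertex to the clique member of its colour is an endomorphism of the graph \<open>E\<close>, so the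
  generated monoid consists of endomorphisms. A constant map would send an edge to a loop.
\<close>

lemma not_synchronizing_if_clique_colouring:
  assumes irrefl: "\<And>x. x \<in> \<Omega> \<Longrightarrow> \<not> E x x"
    and G: "\<And>g. g \<in> G \<Longrightarrow> g \<in> \<Omega> \<rightarrow>\<^sub>E \<Omega>"
    and G_E: "\<And>g x y. g \<in> G \<Longrightarrow> x \<in> \<Omega> \<Longrightarrow> y \<in> \<Omega> \<Longrightarrow> E x y \<Longrightarrow> E (g x) (g y)"
    and K: "K \<subseteq> \<Omega>" and clique: "\<And>x y. x \<in> K \<Longrightarrow> y \<in> K \<Longrightarrow> x \<noteq> y \<Longrightarrow> E x y"
    and proper: "\<And>x y. x \<in> \<Omega> \<Longrightarrow> y \<in> \<Omega> \<Longrightarrow> E x y \<Longrightarrow> col x \<noteq> col y"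
    and all_colours: "col ` \<Omega> \<subseteq> col ` K"
    and not_inj: "\<not> inj_on col \<Omega>"
    and edge: "u \<in> \<Omega>" "v \<in> \<Omega>" "E u v"
  shows "\<not> synchronizing \<Omega> G"
proof
  assume sync: "synchronizing \<Omega> G"
  define f where "f = (\<lambda>x\<in>\<Omega>. inv_into K col (col x))"
  have f_K: "f x \<in> K" "col (f x) = col x" if "x \<in> \<Omega>" for x
    using that all_colours by (auto simp: f_def inv_into_into f_inv_into_f image_subset_iff)
  have f_E: "E (f x) (f y)" if "x \<in> \<Omega>" "y \<in> \<Omega>" "E x y" for x y
    using that f_K proper by (metis clique)
  have f_ext: "f \<in> \<Omega> \<rightarrow>\<^sub>E \<Omega>"
    using f_K(1) K by (auto simp: f_def)
  have "f \<notin> Bij \<Omega>"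
  proof
    assume "f \<in> Bij \<Omega>"
    then have "inj_on f \<Omega>" by (simp add: Bij_def bij_betw_def)
    moreover obtain x y where "x \<in> \<Omega>" "y \<in> \<Omega>" "x \<noteq> y" "col x = col y"
      using not_inj by (auto simp: inj_on_def)
    moreover from this have "f x = f y" by (simp add: f_def)
    ultimately show False by (auto dest: inj_onD)
  qed
  then obtain h a where h: "h \<in> monoid_generate (transformation_monoid \<Omega>) (G \<union> {f})"
    and a: "a \<in> \<Omega>" "\<forall>x\<in>\<Omega>. h x = a"
    using sync f_ext by (auto simp: synchronizing_def)
  from h have "h \<in> \<Omega> \<rightarrow>\<^sub>E \<Omega> \<and> (\<forall>x\<in>\<Omega>. \<forall>y\<in>\<Omega>. E x y \<longrightarrow> E (h x) (h y))"
  proof induction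
    case (incl s)
    then show ?case using G G_E f_ext f_E by blast
  next
    case (mult s s')
    then have "compose \<Omega> s s' \<in> \<Omega> \<rightarrow>\<^sub>E \<Omega>"
      by (auto simp: compose_def PiE_iff extensional_def)
    moreover have "E (compose \<Omega> s s' x) (compose \<Omega> s s' y)" if "x \<in> \<Omega>" "y \<in> \<Omega>" "E x y" for x y
      using mult.IH that by (auto simp: compose_def PiE_iff)
    ultimately show ?case
      by (simp add: transformation_monoid_def)
  qed (auto simp: transformation_monoid_def)
  then show False using edge a irrefl by metis
qed

section \<open>The action on partitions\<close>

lemma part_through_unique:
  assumes "P \<in> kl_partitions k l" "B \<in> P" "C \<in> P" "x \<in> B" "x \<in> C"
  shows "B = C"
  using assms unfolding kl_partitions_def partition_on_def disjoint_def by blast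

text \<open>
  Exchange a point \<open>x\<close> of a part \<open>C\<close> with a point of another part \<open>D\<close>, both different from \<open>B\<close>. A
  second point \<open>z\<close> of \<open>C\<close> stays in place, so the partition changes.
\<close>

lemma ex_distinct_partition_same_part:
  assumes "k \<ge> 3" and "l \<ge> 2" and P: "P \<in> kl_partitions k l" and B: "B \<in> P"
  shows "\<exists>Q \<in> kl_partitions k l. B \<in> Q \<and> Q \<noteq> P"
proof -
  have card: "card P = k" "\<And>C. C \<in> P \<Longrightarrow> card C = l" and un: "\<Union>P = {1..k * l}"
    using P by (auto simp: kl_partitions_def partition_on_def)
  have finP: "finite P" using card assms(1) by (intro card_ge_0_finite) simp
  have "card (P - {B}) \<ge> 2" using card(1) assms(1) B finP by simp
  then obtain C D where CD: "C \<in> P" "D \<in> P" "C \<noteq> B" "D \<noteq> B" "C \<noteq> D"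
    by (metis DiffE card_le_Suc0_iff_eq finP finite_Diff insertI1 not_less_eq_eq numeral_2_eq_2)
  have "\<not> card C \<le> Suc 0" "\<not> card D \<le> Suc 0" using card(2) CD assms(2) by auto
  then obtain x z y where xyz: "x \<in> C" "z \<in> C" "x \<noteq> z" "y \<in> D"
    by (metis card.empty card_le_Suc0_iff_eq card.infinite ex_in_conv le0)
  let ?s = "transpose x y"
  have neq: "y \<noteq> z" "x \<notin> B" "y \<notin> B"
    using part_through_unique[OF P] CD xyz B by metis+
  have perm: "?s permutes {1..k * l}"
    using xyz CD un by (intro permutes_swap_id) auto
  let ?Q = "(`) ?s ` P"
  have "?Q \<in> kl_partitions k l" using kl_action_closed[OF perm P] .
  moreover have "?s ` B = B"
    using neq by (auto simp: transpose_def image_iff)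
  then have "B \<in> ?Q" using B by (metis imageI)
  moreover have "?Q \<noteq> P"
  proof
    assume "?Q = P"
    then have "?s ` C \<in> P" using CD(1) by blast
    moreover have "?s x \<in> ?s ` C" "?s z \<in> ?s ` C" using xyz by blast+
    then have "y \<in> ?s ` C" "z \<in> ?s ` C" using xyz neq by (simp_all add: transpose_def)
    ultimately show False
      using part_through_unique[OF P] CD xyz by metis
  qed
  ultimately show ?thesis by blast
qed

text \<open>
  The graph joins partitions without a common part, the colour is the part through \<open>1\<close>, and the
  clique is the family from Baranyai's theorem.
\<close>

lemma not_synchronizing_kl_partitions:
  assumes k: "k \<ge> 3" and l: "l \<ge> 2" and G: "G \<subseteq> kl_action k l ` {p. p permutes {1..k * l}}"
  shows "\<not> synchronizing (kl_partitions k l) G"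
proof -
  let ?\<Omega> = "kl_partitions k l"
  obtain K where K: "K \<subseteq> ?\<Omega>"
    and K1: "\<And>S. S \<subseteq> {1..k * l} \<Longrightarrow> card S = l \<Longrightarrow> \<exists>!P. P \<in> K \<and> S \<in> P"
    using baranyai[of l k] l by auto
  define part1 where "part1 P = (THE B. B \<in> P \<and> 1 \<in> B)" for P :: "nat set set"
  have part1_eq: "part1 P = B" if "P \<in> ?\<Omega>" "B \<in> P" "1 \<in> B" for P B
    unfolding part1_def using that part_through_unique[OF that(1)] by (intro the_equality) auto
  have kl: "3 * 2 \<le> k * l" using k l by (intro mult_le_mono)
  have part1: "part1 P \<in> P" "1 \<in> part1 P" if "P \<in> ?\<Omega>" for P
  proof -
    have "\<Union>P = {1..k * l}" using that by (simp add: kl_partitions_def partition_on_def)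
    moreover have "1 \<le> k * l" using kl by linarith
    ultimately have "1 \<in> \<Union>P" by (simp only: atLeastAtMost_iff order_refl)
    then show "part1 P \<in> P" "1 \<in> part1 P" using part1_eq[OF that] by auto
  qed
  have part_ok: "B \<subseteq> {1..k * l}" "card B = l" if "P \<in> ?\<Omega>" "B \<in> P" for P B
    using that by (auto simp: kl_partitions_def partition_on_def)
  have clique: "P \<inter> Q = {}" if "P \<in> K" "Q \<in> K" "P \<noteq> Q" for P Q
  proof (rule ccontr)
    assume "P \<inter> Q \<noteq> {}"
    then obtain B where B: "B \<in> P" "B \<in> Q" by blast
    moreover from this have "B \<subseteq> {1..k * l}" "card B = l" using part_ok that K by blast+
    ultimately show False using K1 that by blast
  qed
  \<comment> \<open>An edge exists because two different \<open>l\<close>-sets contain the point \<open>1\<close>: the members of the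
    clique that they belong to are different.\<close>
  have "Suc l \<le> k * l" using l mult_le_mono1[OF k, of l] by linarith
  then have "{1..Suc l} \<subseteq> {1..k * l}" by (simp only: atLeastatMost_subset_iff order_refl simp_thms)
  moreover have "{1..l} \<subseteq> {1..Suc l}" "insert (Suc l) {1..<l} \<subseteq> {1..Suc l}" by auto
  ultimately have S12: "{1..l} \<subseteq> {1..k * l}" "insert (Suc l) {1..<l} \<subseteq> {1..k * l}"
    by blast+
  obtain P1 where P1: "P1 \<in> K" "{1..l} \<in> P1"
    using K1[OF S12(1)] by auto
  obtain P2 where P2: "P2 \<in> K" "insert (Suc l) {1..<l} \<in> P2"
    using K1[OF S12(2)] l by auto
  have "P1 \<noteq> P2"
  proof
    assume "P1 = P2"
    then have "{1..l} = insert (Suc l) {1..<l}"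
      using P1 P2 K l by (intro part_through_unique[of P1 k l _ _ 1]) auto
    then have "Suc l \<in> {1..l}" by blast
    then show False by simp
  qed
  show ?thesis
  proof (rule not_synchronizing_if_clique_colouring[
        where E = "\<lambda>P Q. P \<inter> Q = {}" and K = K and col = part1 and u = P1 and v = P2])
    show "\<not> P \<inter> P = {}" if "P \<in> ?\<Omega>" for P
      using part1(1)[OF that] by auto
    show "g \<in> ?\<Omega> \<rightarrow>\<^sub>E ?\<Omega>" if "g \<in> G" for g
      using that G kl_action_closed by (auto simp: kl_action_def)
    show "g P \<inter> g Q = {}" if "g \<in> G" "P \<in> ?\<Omega>" "Q \<in> ?\<Omega>" "P \<inter> Q = {}" for g P Q
    proof -
      obtain p where p: "p permutes {1..k * l}" "g = kl_action k l p" using G \<open>g \<in> G\<close> by blast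
      have "inj ((`) p)" using permutes_inj[OF p(1)] by (simp add: inj_image_eq_iff inj_def)
      then show ?thesis
        using that(2-4) by (simp add: p(2) kl_action_def flip: image_Int)
    qed
    show "part1 P \<noteq> part1 Q" if "P \<in> ?\<Omega>" "Q \<in> ?\<Omega>" "P \<inter> Q = {}" for P Q
      using part1(1)[OF that(1)] part1(1)[OF that(2)] that(3) by auto
    show "part1 ` ?\<Omega> \<subseteq> part1 ` K"
    proof
      fix B assume "B \<in> part1 ` ?\<Omega>"
      then obtain Q where Q: "Q \<in> ?\<Omega>" "B = part1 Q" by blast
      then obtain P where "P \<in> K" "B \<in> P"
        using K1[of B] part_ok part1(1) by blast
      then show "B \<in> part1 ` K"
        using part1_eq[of P B] part1(2) Q K by (auto intro!: image_eqI[of _ _ P])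
    qed
    show "\<not> inj_on part1 ?\<Omega>"
    proof
      assume inj: "inj_on part1 ?\<Omega>"
      have "P1 \<in> ?\<Omega>" using P1 K by blast
      then obtain Q where "Q \<in> ?\<Omega>" "part1 P1 \<in> Q" "Q \<noteq> P1"
        using ex_distinct_partition_same_part[OF k l, of P1] part1(1) by blast
      moreover from this have "part1 Q = part1 P1"
        using part1_eq part1(2) \<open>P1 \<in> ?\<Omega>\<close> by blast
      ultimately show False using inj \<open>P1 \<in> ?\<Omega>\<close> by (auto dest: inj_onD)
    qed
  qed (use K P1 P2 \<open>P1 \<noteq> P2\<close> clique in auto)
qed

theorem theorem1p5:
  fixes k l :: nat
  assumes "k \<ge> 3" and "l \<ge> 2"
  shows "\<not> synchronizing (kl_partitions k l) (kl_action k l ` carrier (sym_group (k * l)))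
       \<and> \<not> synchronizing (kl_partitions k l) (kl_action k l ` carrier (alt_group (k * l)))"
  using assms
  by (intro conjI not_synchronizing_kl_partitions)
    (auto simp: sym_group_def alt_group_def)

end
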